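(* For all real numbers $p,q$ with $0<q\le p<\frac12$ there is a constant $c=c(p,q)$, depending only on $p$ and $q$, with the following property. Let $n\ge1$ and let $\mathbf p=(p_1,\ldots,p_n),\ \mathbf q=(q_1,\ldots,q_n)\in(0,\frac12)^n$ satisfy $p_1=\max_{j\in[n]}p_j=p$ and $q_1=\max_{j\in[n]}q_j=q$. For any real $\varepsilon$, if $\mathcal A,\mathcal B\subseteq 2^{[n]}$ are cross-intersecting and $$\mu_{\mathbf p}(\mathcal A)\,\mu_{\mathbf q}(\mathcal B)\ge(1-\varepsilon)p_1q_1,$$ then there exists $j\in[n]$ such that $$\max\bigl\{\mu_{\mathbf p}(\mathcal A\triangle\mathcal S_j),\ \mu_{\mathbf q}(\mathcal B\triangle\mathcal S_j)\bigr\}\le c\,\varepsilon .$$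
   Context: Here $[n]=\{1,\ldots,n\}$ and $2^{[n]}$ is its power set. Families $\mathcal A,\mathcal B\subseteq 2^{[n]}$ are cross-intersecting if $A\cap B\neq\emptyset$ for all $A\in\mathcal A$, $B\in\mathcal B$. For $\mathbf p\in(0,1)^n$ and $\mathcal A\subseteq 2^{[n]}$, $\mu_{\mathbf p}(\mathcal A)=\sum_{A\in\mathcal A}\prod_{i\in A}p_i\prod_{i\in[n]\setminus A}(1-p_i)$. The star at $j$ is $\mathcal S_j=\{A\subseteq[n]:j\in A\}$, and $\triangle$ denotes symmetric difference of families. *)

theory Defs
  imports Complex_Main
begin

text \<open>Families of subsets of \<open>[n] = {1..n}\<close> have type \<^typ>\<open>nat set set\<close> and are
  contained in \<open>Pow {1..n}\<close>. A vector indexed by \<open>[n]\<close> is a function on \<^typ>\<open>nat\<close> whose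
  values outside \<open>{1..n}\<close> are irrelevant.\<close>

definition cross_intersecting :: "'a set set \<Rightarrow> 'a set set \<Rightarrow> bool" where
  "cross_intersecting \<A> \<B> \<longleftrightarrow> (\<forall>A\<in>\<A>. \<forall>B\<in>\<B>. A \<inter> B \<noteq> {})"

definition biased_measure :: "nat \<Rightarrow> (nat \<Rightarrow> real) \<Rightarrow> nat set set \<Rightarrow> real" where
  "biased_measure n p \<A> = (\<Sum>A\<in>\<A>. (\<Prod>i\<in>A. p i) * (\<Prod>i\<in>{1..n} - A. 1 - p i))"

definition star :: "nat \<Rightarrow> nat \<Rightarrow> nat set set" where
  "star n j = {A. A \<subseteq> {1..n} \<and> j \<in> A}"

end

theory Submission
  imports Defs
begin

text \<open>Passing to up-closures and raising all weights to \<open>p\<close> and \<open>q\<close> only increases the two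
  measures, so one may assume that \<open>\<A>\<close>, \<open>\<B>\<close> are up-sets and the weights are constant. At a
  coordinate \<open>i\<close> let \<open>x \<le> A\<close> and \<open>y \<le> B\<close> be the measures of the lower and upper sections
  of \<open>\<A>\<close> and \<open>\<B>\<close>, and let \<open>\<alpha> = (1 - p) / p\<close>, \<open>\<beta> = (1 - q) / q\<close>, \<open>\<gamma> = \<alpha> \<beta>\<close>; the product
  of the two measures is \<open>p q (\<alpha> x + A) (\<beta> y + B)\<close>. Every cross-intersecting pair of measures
  satisfies \<open>\<gamma> a b \<le> (1 - a) (1 - b)\<close>. If \<open>\<gamma>\<^sup>2 x y \<le> (1 - x) (1 - y)\<close>, applying this to the
  pairs \<open>(x, B)\<close> and \<open>(A, y)\<close> bounds the product by \<open>p q (1 - \<kappa> (x + y))\<close>, so a near-extremal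
  pair has \<open>x + y = O(\<epsilon>)\<close> and is close to the star at \<open>i\<close>. Otherwise \<open>A \<le> \<gamma> x\<close> and
  \<open>B \<le> \<gamma> y\<close>, and then one of the pairs of sections \<open>(x, B)\<close>, \<open>(A, y)\<close> has at least as large
  a product. By induction it is close to a star at some \<open>j\<close>; hence one of the lower sections of
  \<open>\<A>\<close>, \<open>\<B>\<close> at \<open>j\<close> is small, which puts the coordinate \<open>j\<close> in the first case for
  \<open>\<A>\<close>, \<open>\<B>\<close> themselves. Thus the constant does not deteriorate along the induction.\<close>

section \<open>Product measures and sections\<close>

definition prod_measure :: "'a set \<Rightarrow> ('a \<Rightarrow> real) \<Rightarrow> 'a set set \<Rightarrow> real" where
  "prod_measure I w A = (\<Sum>S\<in>Pow I \<inter> A. (\<Prod>i\<in>S. w i) * (\<Prod>i\<in>I - S. 1 - w i))"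

text \<open>Closure ranges over the whole type rather than over the subsets of a ground set, so the
  property is unaffected when an induction removes coordinates.\<close>

definition upclosed :: "'a set set \<Rightarrow> bool" where
  "upclosed A \<longleftrightarrow> (\<forall>S T. S \<in> A \<longrightarrow> S \<subseteq> T \<longrightarrow> T \<in> A)"

text \<open>Families are arbitrary sets of sets, only measured on \<open>Pow I\<close>. The sections at \<open>i\<close> ignore
  \<open>i\<close> rather than forbid it, so that they stay up-closed and the ground set need not change.\<close>

definition section0 :: "'a \<Rightarrow> 'a set set \<Rightarrow> 'a set set" where
  "section0 i A = {S. S - {i} \<in> A}"

definition section1 :: "'a \<Rightarrow> 'a set set \<Rightarrow> 'a set set" where
  "section1 i A = {S. insert i S \<in> A}"

lemma upclosed_sections:
  assumes "upclosed A"
  shows "upclosed (section0 i A)" "upclosed (section1 i A)"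
proof -
  show "upclosed (section0 i A)"
    using assms unfolding upclosed_def section0_def mem_Collect_eq
    by (meson Diff_mono order_refl)
  show "upclosed (section1 i A)"
    using assms unfolding upclosed_def section1_def mem_Collect_eq
    by (meson insert_mono)
qed

lemma section0_subset_section1: "upclosed A \<Longrightarrow> section0 i A \<subseteq> section1 i A"
  unfolding upclosed_def section0_def section1_def by blast

lemma cross_intersecting_sections:
  assumes "cross_intersecting A B"
  shows "cross_intersecting (section0 i A) (section0 i B)"
    and "cross_intersecting (section0 i A) (section1 i B)"
    and "cross_intersecting (section1 i A) (section0 i B)"
proof -
  have *: "S \<inter> T \<noteq> {}" if "S \<in> A" "T \<in> B" for S T
    using assms that unfolding cross_intersecting_def by blast
  show "cross_intersecting (section0 i A) (section0 i B)"
    unfolding cross_intersecting_def section0_def using * by blast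
  show "cross_intersecting (section0 i A) (section1 i B)"
    unfolding cross_intersecting_def section0_def section1_def using * by blast
  show "cross_intersecting (section1 i A) (section0 i B)"
    unfolding cross_intersecting_def section0_def section1_def using * by blast
qed

lemma section0_idem:
  "section0 i (section0 i A) = section0 i A" "section1 i (section0 i A) = section0 i A"
  unfolding section0_def section1_def by auto

lemma section_commute:
  assumes "i \<noteq> j"
  shows "section1 i (section0 j A) = section0 j (section1 i A)"
proof -
  have "insert i S - {j} = insert i (S - {j})" for S :: "'a set"
    using assms by blast
  then show ?thesis
    unfolding section0_def section1_def by simp
qed

lemma prod_measure_empty: "prod_measure {} w A = (if {} \<in> A then 1 else 0)"
  unfolding prod_measure_def by simp

lemma prod_measure_insert:
  assumes "finite I" "i \<notin> I"
  shows "prod_measure (insert i I) w A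
    = (1 - w i) * prod_measure I w (section0 i A) + w i * prod_measure I w (section1 i A)"
proof -
  let ?f = "\<lambda>S. (\<Prod>k\<in>S. w k) * (\<Prod>k\<in>insert i I - S. 1 - w k)"
  have split: "Pow (insert i I) \<inter> A
      = (Pow I \<inter> section0 i A) \<union> insert i ` (Pow I \<inter> section1 i A)"
  proof (intro equalityI subsetI)
    fix S assume S: "S \<in> Pow (insert i I) \<inter> A"
    show "S \<in> (Pow I \<inter> section0 i A) \<union> insert i ` (Pow I \<inter> section1 i A)"
    proof (cases "i \<in> S")
      case True
      then have eq: "S = insert i (S - {i})" by blast
      with S have "S - {i} \<in> Pow I \<inter> section1 i A"
        unfolding section1_def by auto
      with eq show ?thesis by blast
    next
      case False
      then have "S - {i} = S" by blast
      with S False show ?thesis unfolding section0_def by auto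
    qed
  next
    fix S assume S: "S \<in> (Pow I \<inter> section0 i A) \<union> insert i ` (Pow I \<inter> section1 i A)"
    then show "S \<in> Pow (insert i I) \<inter> A"
    proof
      assume S: "S \<in> Pow I \<inter> section0 i A"
      with assms have "S - {i} = S" by blast
      with S show ?thesis unfolding section0_def by auto
    next
      assume "S \<in> insert i ` (Pow I \<inter> section1 i A)"
      then show ?thesis unfolding section1_def by auto
    qed
  qed
  have disj: "(Pow I \<inter> section0 i A) \<inter> insert i ` (Pow I \<inter> section1 i A) = {}"
    using assms by blast
  have inj: "inj_on (insert i) (Pow I \<inter> section1 i A)"
    using assms by (auto simp: inj_on_def)
  have zero: "?f S = (1 - w i) * ((\<Prod>k\<in>S. w k) * (\<Prod>k\<in>I - S. 1 - w k))" if "S \<subseteq> I" for S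
  proof -
    have "insert i I - S = insert i (I - S)" using that assms by blast
    then show ?thesis using assms by simp
  qed
  have one: "?f (insert i S) = w i * ((\<Prod>k\<in>S. w k) * (\<Prod>k\<in>I - S. 1 - w k))" if "S \<subseteq> I" for S
  proof -
    have "insert i I - insert i S = I - S" "i \<notin> S" "finite S"
      using that assms finite_subset by auto
    then show ?thesis by simp
  qed
  have "prod_measure (insert i I) w A
      = sum ?f (Pow I \<inter> section0 i A) + sum ?f (insert i ` (Pow I \<inter> section1 i A))"
    unfolding prod_measure_def split using assms disj by (intro sum.union_disjoint) auto
  also have "sum ?f (insert i ` (Pow I \<inter> section1 i A))
      = (\<Sum>S\<in>Pow I \<inter> section1 i A. ?f (insert i S))"
    using inj by (simp add: sum.reindex)
  also have "\<dots> = w i * prod_measure I w (section1 i A)"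
    unfolding prod_measure_def sum_distrib_left by (rule sum.cong) (use one in auto)
  also have "sum ?f (Pow I \<inter> section0 i A) = (1 - w i) * prod_measure I w (section0 i A)"
    unfolding prod_measure_def sum_distrib_left by (rule sum.cong) (use zero in auto)
  finally show ?thesis .
qed

text \<open>The sections at \<open>i\<close> do not depend on \<open>i\<close>, so they have the
  same measure over \<open>I\<close> as over \<open>I - {i}\<close>; the recursion therefore also
  holds with \<open>i\<close> left in the ground set.\<close>

lemma prod_measure_split:
  assumes "finite I" "i \<in> I"
  shows "prod_measure I w A
    = (1 - w i) * prod_measure I w (section0 i A) + w i * prod_measure I w (section1 i A)"
proof -
  have I: "insert i (I - {i}) = I" using assms by blast
  have rec: "prod_measure I w C = (1 - w i) * prod_measure (I - {i}) w (section0 i C)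
      + w i * prod_measure (I - {i}) w (section1 i C)" for C
    using prod_measure_insert[of "I - {i}" i w C] assms I by simp
  have idem: "section0 i (section1 i A) = section1 i A" "section1 i (section1 i A) = section1 i A"
    unfolding section0_def section1_def by auto
  have "prod_measure I w (section0 i A) = prod_measure (I - {i}) w (section0 i A)"
    using rec[of "section0 i A"] by (simp add: section0_idem algebra_simps)
  moreover have "prod_measure I w (section1 i A) = prod_measure (I - {i}) w (section1 i A)"
    using rec[of "section1 i A"] by (simp add: idem algebra_simps)
  ultimately show ?thesis using rec[of A] by simp
qed

lemma prod_measure_mono:
  assumes "finite I" "\<forall>i\<in>I. 0 \<le> w i \<and> w i \<le> 1" "Pow I \<inter> A \<subseteq> C"
  shows "prod_measure I w A \<le> prod_measure I w C"
  unfolding prod_measure_def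
proof (rule sum_mono2)
  show "finite (Pow I \<inter> C)" using assms by simp
  show "Pow I \<inter> A \<subseteq> Pow I \<inter> C" using assms by blast
  fix S assume "S \<in> Pow I \<inter> C - Pow I \<inter> A"
  then have "S \<subseteq> I" by blast
  then show "0 \<le> (\<Prod>i\<in>S. w i) * (\<Prod>i\<in>I - S. 1 - w i)"
    using assms by (intro mult_nonneg_nonneg prod_nonneg) auto
qed

lemma prod_measure_UNIV:
  assumes "finite I"
  shows "prod_measure I w UNIV = 1"
  using assms
proof (induction I rule: finite_induct)
  case (insert i I)
  have "section0 i UNIV = UNIV" "section1 i UNIV = UNIV"
    unfolding section0_def section1_def by auto
  with insert show ?case by (simp add: prod_measure_insert)
qed (simp add: prod_measure_empty)

lemma prod_measure_nonneg:
  assumes "finite I" "\<forall>i\<in>I. 0 \<le> w i \<and> w i \<le> 1"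
  shows "0 \<le> prod_measure I w A"
  using prod_measure_mono[OF assms, of "{}" A] by (simp add: prod_measure_def)

lemma prod_measure_le_1:
  assumes "finite I" "\<forall>i\<in>I. 0 \<le> w i \<and> w i \<le> 1"
  shows "prod_measure I w A \<le> 1"
  using prod_measure_mono[OF assms, of A UNIV] prod_measure_UNIV[OF assms(1)] by simp

text \<open>For an up-set the upper section at a coordinate is at least as large as the lower one,
  so moving weight towards it increases the average.\<close>

lemma prod_measure_weight_mono:
  assumes "finite I" "\<forall>i\<in>I. 0 \<le> v i \<and> v i \<le> w i \<and> w i \<le> 1" "upclosed A"
  shows "prod_measure I v A \<le> prod_measure I w A"
  using assms
proof (induction I arbitrary: A rule: finite_induct)
  case (insert i I)
  let ?v0 = "prod_measure I v (section0 i A)" and ?v1 = "prod_measure I v (section1 i A)"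
  let ?w0 = "prod_measure I w (section0 i A)" and ?w1 = "prod_measure I w (section1 i A)"
  have le: "?v0 \<le> ?w0" "?v1 \<le> ?w1"
    using insert.IH insert.prems upclosed_sections[OF insert.prems(2)] by blast+
  have sec: "?w0 \<le> ?w1"
  proof (rule prod_measure_mono)
    show "Pow I \<inter> section0 i A \<subseteq> section1 i A"
      using section0_subset_section1[OF insert.prems(2)] by blast
    show "\<forall>k\<in>I. 0 \<le> w k \<and> w k \<le> 1" using insert.prems(1) by force
  qed (use insert in auto)
  have vi: "0 \<le> v i" "v i \<le> w i" "w i \<le> 1" using insert.prems by auto
  have "(1 - v i) * ?v0 + v i * ?v1 \<le> (1 - v i) * ?w0 + v i * ?w1"
    using le vi by (intro add_mono mult_left_mono) auto
  also have "\<dots> = ?w0 + v i * (?w1 - ?w0)" by (simp add: algebra_simps)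
  also have "\<dots> \<le> ?w0 + w i * (?w1 - ?w0)"
    using vi sec by (intro add_left_mono mult_right_mono) auto
  also have "\<dots> = (1 - w i) * ?w0 + w i * ?w1" by (simp add: algebra_simps)
  finally show ?case using insert by (simp add: prod_measure_insert)
qed (simp add: prod_measure_empty)

section \<open>The correlation bound\<close>

text \<open>Couple the two measures through the distribution on disjoint pairs that, at each coordinate,
  takes the values \<open>(1, 0)\<close>, \<open>(0, 1)\<close>, \<open>(0, 0)\<close> with probabilities \<open>p\<close>, \<open>q\<close>, \<open>1 - p - q\<close>. Its
  maximal correlation is \<open>\<sigma>\<close>, and \<open>a b\<close> is minus the covariance of the two indicators.
  Quantifying over \<open>l\<close> and \<open>m\<close> replaces Cauchy-Schwarz in the induction.\<close>

lemma correlation_step: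
  fixes p q \<sigma> a0 a1 b0 b1 l m :: real
  assumes pq: "0 < p" "0 < q" "p + q \<le> 1"
    and \<sigma>: "0 \<le> \<sigma>" "\<sigma>\<^sup>2 * ((1 - p) * (1 - q)) = p * q"
    and h00: "2 * l * m * (a0 * b0) \<le> \<sigma> * (l\<^sup>2 * (a0 * (1 - a0)) + m\<^sup>2 * (b0 * (1 - b0)))"
    and h01: "2 * l * m * (a0 * b1) \<le> \<sigma> * (l\<^sup>2 * (a0 * (1 - a0)) + m\<^sup>2 * (b1 * (1 - b1)))"
    and h10: "2 * l * m * (a1 * b0) \<le> \<sigma> * (l\<^sup>2 * (a1 * (1 - a1)) + m\<^sup>2 * (b0 * (1 - b0)))"
  defines "a \<equiv> (1 - p) * a0 + p * a1" and "b \<equiv> (1 - q) * b0 + q * b1"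
  shows "2 * l * m * (a * b) \<le> \<sigma> * (l\<^sup>2 * (a * (1 - a)) + m\<^sup>2 * (b * (1 - b)))"
proof -
  \<comment> \<open>\<open>P\<close> and \<open>Q\<close> are the standard deviations of the two
    coupled bits. Their covariance is \<open>- p * q\<close>, so the condition on
    \<open>\<sigma>\<close> amounts to \<open>\<sigma> * (P * Q) = p * q\<close>.\<close>
  define P where "P = sqrt (p * (1 - p))"
  define Q where "Q = sqrt (q * (1 - q))"
  have sq: "P\<^sup>2 = p * (1 - p)" "Q\<^sup>2 = q * (1 - q)" "0 \<le> P" "0 \<le> Q"
    using pq unfolding P_def Q_def by auto
  have "(\<sigma> * (P * Q))\<^sup>2 = (p * q)\<^sup>2"
  proof -
    have "(\<sigma> * (P * Q))\<^sup>2 = \<sigma>\<^sup>2 * ((1 - p) * (1 - q)) * (p * q)"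
      by (simp add: power_mult_distrib sq)
    also have "\<dots> = (p * q)\<^sup>2" unfolding \<sigma>(2) by (simp add: power2_eq_square)
    finally show ?thesis .
  qed
  then have PQ: "\<sigma> * (P * Q) = p * q"
    using \<sigma> sq pq by (simp add: power2_eq_iff_nonneg)
  define d e where "d = a1 - a0" and "e = b1 - b0"
  have "0 \<le> \<sigma> * (l * P * d - m * Q * e)\<^sup>2"
    using \<sigma> by simp
  also have "\<dots> = \<sigma> * (l\<^sup>2 * (p * (1 - p)) * d\<^sup>2 + m\<^sup>2 * (q * (1 - q)) * e\<^sup>2)
      - 2 * l * m * (\<sigma> * (P * Q)) * d * e"
    unfolding sq(1,2)[symmetric] by (simp add: power2_eq_square algebra_simps)
  finally have cov: "2 * l * m * (p * q) * d * e
      \<le> \<sigma> * (l\<^sup>2 * (p * (1 - p)) * d\<^sup>2 + m\<^sup>2 * (q * (1 - q)) * e\<^sup>2)"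
    using PQ by simp
  have t00: "(1 - p - q) * (2 * l * m * (a0 * b0))
      \<le> (1 - p - q) * (\<sigma> * (l\<^sup>2 * (a0 * (1 - a0)) + m\<^sup>2 * (b0 * (1 - b0))))"
    using h00 pq by (intro mult_left_mono) auto
  have t01: "q * (2 * l * m * (a0 * b1))
      \<le> q * (\<sigma> * (l\<^sup>2 * (a0 * (1 - a0)) + m\<^sup>2 * (b1 * (1 - b1))))"
    using h01 pq by (intro mult_left_mono) auto
  have t10: "p * (2 * l * m * (a1 * b0))
      \<le> p * (\<sigma> * (l\<^sup>2 * (a1 * (1 - a1)) + m\<^sup>2 * (b0 * (1 - b0))))"
    using h10 pq by (intro mult_left_mono) auto
  \<comment> \<open>Average over the three outcomes of the coupling. The outcome
    \<open>(1, 1)\<close> is absent because two upper sections need not cross-intersect; the last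
    term compensates for this. The identity \<open>rhs\<close> is the law of total variance.\<close>
  have lhs: "2 * l * m * (a * b) = (1 - p - q) * (2 * l * m * (a0 * b0))
      + q * (2 * l * m * (a0 * b1)) + p * (2 * l * m * (a1 * b0)) + 2 * l * m * (p * q) * d * e"
    unfolding a_def b_def d_def e_def by algebra
  have rhs: "\<sigma> * (l\<^sup>2 * (a * (1 - a)) + m\<^sup>2 * (b * (1 - b)))
      = (1 - p - q) * (\<sigma> * (l\<^sup>2 * (a0 * (1 - a0)) + m\<^sup>2 * (b0 * (1 - b0))))
      + q * (\<sigma> * (l\<^sup>2 * (a0 * (1 - a0)) + m\<^sup>2 * (b1 * (1 - b1))))
      + p * (\<sigma> * (l\<^sup>2 * (a1 * (1 - a1)) + m\<^sup>2 * (b0 * (1 - b0))))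
      + \<sigma> * (l\<^sup>2 * (p * (1 - p)) * d\<^sup>2 + m\<^sup>2 * (q * (1 - q)) * e\<^sup>2)"
    unfolding a_def b_def d_def e_def by algebra
  show ?thesis unfolding lhs rhs using cov t00 t01 t10 by linarith
qed

text \<open>Induction on the ground set: the three pairs of sections other than the two upper ones
  stay cross-intersecting, as \<open>correlation_step\<close> requires. Without coordinates, the
  product and both variances vanish.\<close>

lemma correlation_quadratic_form:
  fixes p q \<sigma> l m :: real
  assumes pq: "0 < p" "0 < q" "p + q \<le> 1"
    and \<sigma>: "0 \<le> \<sigma>" "\<sigma>\<^sup>2 * ((1 - p) * (1 - q)) = p * q"
    and "finite I" "cross_intersecting A B"
  defines "a \<equiv> prod_measure I (\<lambda>_. p) A" and "b \<equiv> prod_measure I (\<lambda>_. q) B"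
  shows "2 * l * m * (a * b) \<le> \<sigma> * (l\<^sup>2 * (a * (1 - a)) + m\<^sup>2 * (b * (1 - b)))"
  unfolding a_def b_def using assms(6,7)
proof (induction I arbitrary: A B rule: finite_induct)
  case empty
  then have "{} \<notin> A \<or> {} \<notin> B"
    unfolding cross_intersecting_def by blast
  then show ?case by (auto simp: prod_measure_empty)
next
  case (insert i I)
  show ?case
    unfolding prod_measure_insert[OF insert(1,2)]
    by (rule correlation_step[OF pq \<sigma>]; rule insert.IH)
      (use cross_intersecting_sections[OF insert.prems] in auto)
qed

text \<open>A Hoffman-type bound. The quadratic form in \<open>l\<close> and \<open>m\<close> has a
  sign, so its discriminant gives
  \<open>(a * b)\<^sup>2 \<le> s * (a * (1 - a)) * (b * (1 - b))\<close>, and \<open>a * b\<close>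
  cancels. Equality holds for two copies of one star, where \<open>a = p\<close> and
  \<open>b = q\<close>.\<close>

lemma correlation_bound:
  fixes p q :: real
  assumes pq: "0 < p" "0 < q" "p + q \<le> 1"
    and "finite I" "cross_intersecting A B"
  defines "a \<equiv> prod_measure I (\<lambda>_. p) A" and "b \<equiv> prod_measure I (\<lambda>_. q) B"
  shows "(1 - p) / p * ((1 - q) / q) * (a * b) \<le> (1 - a) * (1 - b)"
proof -
  define s where "s = p * q / ((1 - p) * (1 - q))"
  have s: "0 < s" unfolding s_def using pq by simp
  have s_inv: "(1 - p) / p * ((1 - q) / q) = 1 / s" unfolding s_def by simp
  have form: "2 * l * m * (a * b) \<le> sqrt s * (l\<^sup>2 * (a * (1 - a)) + m\<^sup>2 * (b * (1 - b)))" for l m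
    unfolding a_def b_def using s pq assms(4,5)
    by (intro correlation_quadratic_form) (auto simp: s_def)
  have a01: "0 \<le> a" "a \<le> 1" "0 \<le> b" "b \<le> 1"
    unfolding a_def b_def using pq assms(4)
    by (auto intro!: prod_measure_nonneg prod_measure_le_1)
  consider "a = 0 \<or> b = 0" | "a = 1" "b > 0" | "0 < a" "a < 1" "0 < b"
    using a01 by linarith
  then show ?thesis
  proof cases
    case 1
    then show ?thesis using a01 by auto
  next
    case 2
    have "sqrt s * (2 * b) \<le> sqrt s * (b * (1 - b))"
      using form[of "sqrt s" 1] 2 by (simp add: mult_ac)
    then have "2 * b \<le> b * (1 - b)"
      using s by simp
    moreover have "b * (1 - b) \<le> b * 1"
      using a01 by (intro mult_left_mono) auto
    ultimately show ?thesis using 2 by simp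
  next
    case 3
    define v where "v = a * (1 - a)"
    have v: "0 < v" unfolding v_def using 3 by simp
    \<comment> \<open>The ratio \<open>l / m = a * b / (sqrt s * v)\<close> is optimal for fixed
      \<open>m\<close>. It requires \<open>v > 0\<close>, hence the separate case
      \<open>a = 1\<close>.\<close>
    have "2 * (a * b) * (sqrt s * v) * (a * b)
        \<le> sqrt s * ((a * b)\<^sup>2 * v + (sqrt s * v)\<^sup>2 * (b * (1 - b)))"
      using form[of "a * b" "sqrt s * v"] unfolding v_def by simp
    then have "(sqrt s * v) * (2 * (a * b)\<^sup>2)
        \<le> (sqrt s * v) * ((a * b)\<^sup>2 + s * v * (b * (1 - b)))"
      using s by (simp add: power_mult_distrib power2_eq_square algebra_simps)
    then have "(a * b)\<^sup>2 \<le> s * v * (b * (1 - b))"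
      using s v by simp
    then have "(a * b) * (a * b) \<le> (a * b) * (s * ((1 - a) * (1 - b)))"
      unfolding v_def by (simp add: power2_eq_square algebra_simps)
    then have "a * b \<le> s * ((1 - a) * (1 - b))"
      using 3 by simp
    then show ?thesis unfolding s_inv using s by (simp add: field_simps)
  qed
qed

section \<open>The two-point inequality\<close>

text \<open>Expand the left-hand side and compare with \<open>x * B\<close>. The mixed terms are
  immediate; for \<open>\<alpha> * \<beta> * (x * y) + A * B\<close>, use that \<open>B\<close> lies
  between \<open>y\<close> and \<open>\<alpha> * \<beta> * y\<close>, so
  \<open>(B - y) * (\<alpha> * \<beta> * y - B)\<close> is nonnegative.\<close>

lemma reducible_step_aux:
  fixes \<alpha> \<beta> x y A B :: real
  assumes "1 < \<alpha>" "1 < \<beta>" "0 \<le> x" "0 \<le> y" "x \<le> A" "y \<le> B"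
    and "A \<le> \<alpha> * \<beta> * x" "B \<le> \<alpha> * \<beta> * y" "A * y \<le> x * B"
  shows "(\<alpha> * x + A) * (\<beta> * y + B) \<le> (1 + \<alpha>) * (1 + \<beta>) * (x * B)"
proof (cases "y = 0")
  case True
  then have "B = 0" using assms by simp
  then show ?thesis using True by simp
next
  case False
  then have y: "0 < y" using assms by simp
  have "x * ((B - y) * (\<alpha> * \<beta> * y - B)) \<ge> 0"
    using assms by simp
  moreover have "A * y * B \<le> x * B * B"
    using assms by (intro mult_right_mono) auto
  ultimately have "y * (\<alpha> * \<beta> * (x * y) + A * B) \<le> y * ((1 + \<alpha> * \<beta>) * (x * B))"
    by (simp add: algebra_simps)
  then have "\<alpha> * \<beta> * (x * y) + A * B \<le> (1 + \<alpha> * \<beta>) * (x * B)"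
    using y by simp
  moreover have "\<beta> * (A * y) \<le> \<beta> * (x * B)"
    using assms by (intro mult_left_mono) auto
  ultimately show ?thesis by (simp add: algebra_simps)
qed

text \<open>In the application \<open>1 + \<alpha> = 1 / p\<close> and
  \<open>1 + \<beta> = 1 / q\<close>, so the product of the two measures is at most that of one of
  the two mixed pairs of sections.\<close>

lemma reducible_step:
  fixes \<alpha> \<beta> x y A B :: real
  assumes "1 < \<alpha>" "1 < \<beta>" "0 \<le> x" "0 \<le> y" "x \<le> A" "y \<le> B"
    and "A \<le> \<alpha> * \<beta> * x" "B \<le> \<alpha> * \<beta> * y"
  shows "(\<alpha> * x + A) * (\<beta> * y + B) \<le> (1 + \<alpha>) * (1 + \<beta>) * max (x * B) (A * y)"
proof (cases "A * y \<le> x * B")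
  case True
  then show ?thesis using reducible_step_aux[of \<alpha> \<beta> x y A B] assms by simp
next
  case False
  then have "(\<beta> * y + B) * (\<alpha> * x + A) \<le> (1 + \<beta>) * (1 + \<alpha>) * (y * A)"
    using assms by (intro reducible_step_aux) (auto simp: mult_ac)
  then show ?thesis using False by (simp add: mult_ac max_def)
qed

lemma nonreducible_section:
  fixes \<gamma> x y B :: real
  assumes "1 < \<gamma>" "0 \<le> x" "x \<le> 1" "0 \<le> y"
    and K: "\<gamma> * (x * B) \<le> (1 - x) * (1 - B)" and "\<gamma> * y < B"
  shows "\<gamma>\<^sup>2 * (x * y) \<le> (1 - x) * (1 - y)"
proof -
  define d where "d = 1 + (\<gamma> - 1) * x"
  have d: "0 < d" unfolding d_def using assms by (simp add: add_pos_nonneg)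
  have "\<gamma> * y * d \<le> B * d" using assms d by (intro mult_right_mono) auto
  also have "B * d \<le> 1 - x" using K unfolding d_def by (simp add: algebra_simps)
  finally have 1: "\<gamma> * y * d \<le> 1 - x" .
  have "1 * (y * d) \<le> \<gamma> * (y * d)"
    using assms d by (intro mult_right_mono) auto
  then have "y * d \<le> \<gamma> * y * d" by (simp add: mult_ac)
  with 1 have "\<gamma> * x \<le> (1 - y) * d" unfolding d_def by (simp add: algebra_simps)
  then have "(1 - x) * (\<gamma> * x) \<le> (1 - x) * ((1 - y) * d)"
    using assms by (intro mult_left_mono) auto
  moreover have "(\<gamma> * x) * (\<gamma> * y * d) \<le> (\<gamma> * x) * (1 - x)"
    using 1 assms by (intro mult_left_mono) auto
  ultimately have "\<gamma>\<^sup>2 * (x * y) * d \<le> (1 - x) * (1 - y) * d"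
    by (simp add: power2_eq_square algebra_simps)
  then show ?thesis using d by simp
qed

text \<open>In terms of the odds \<open>o = x / (1 - x)\<close> and \<open>r = y / (1 - y)\<close>, the left-hand side is
  a polynomial divided by \<open>(1 + o)\<^sup>2 (1 + r)\<^sup>2\<close>, and the right-hand side groups it so that
  every summand is visibly nonnegative when \<open>\<alpha>\<^sup>2 \<beta>\<^sup>2 o r \<le> 1\<close>.\<close>

lemma two_point_identity:
  fixes \<alpha> \<beta> x y :: real
  defines "\<gamma> \<equiv> \<alpha> * \<beta>"
  shows "(1 + (\<gamma> - 1) * x) * (1 + (\<gamma> - 1) * y)
      - (\<alpha> * x * (1 + (\<gamma> - 1) * y) + (1 - y)) * (\<beta> * y * (1 + (\<gamma> - 1) * x) + (1 - x))
    = \<alpha> * (\<beta> - 1) * (x * (1 - y)) * ((1 - x) * (1 - y) - \<beta> * (x * y))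
      + \<beta> * (\<alpha> - 1) * (y * (1 - x)) * ((1 - x) * (1 - y) - \<alpha> * (x * y))
      + \<gamma> * (x - y)\<^sup>2
      + (1 + \<gamma>) * ((\<alpha> - 1) * (\<beta> - 1)) * (x * y * ((1 - x) * (1 - y)))
      + (\<gamma> - 1) * (x * y) * ((1 - x) * (1 - y) - \<gamma>\<^sup>2 * (x * y))"
  unfolding \<gamma>_def by (simp add: power2_eq_square algebra_simps)

text \<open>The correlation bounds cap \<open>A\<close> by \<open>(1 - y) / dy\<close> and
  \<open>B\<close> by \<open>(1 - x) / dx\<close>. After clearing denominators the slack is
  \<open>N\<close>, the expression of \<open>two_point_identity\<close>. It grows linearly in
  \<open>x + y\<close>: through its first two summands while \<open>x\<close> and \<open>y\<close>
  stay away from 1, and through the square otherwise.\<close>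

lemma two_point_bound:
  fixes \<alpha> \<beta> :: real
  assumes "1 < \<alpha>" "1 < \<beta>"
  defines "\<gamma> \<equiv> \<alpha> * \<beta>"
  shows "\<exists>\<kappa>>0. \<forall>x y A B. 0 \<le> x \<longrightarrow> x \<le> 1 \<longrightarrow> 0 \<le> y \<longrightarrow> y \<le> 1 \<longrightarrow> 0 \<le> A \<longrightarrow> 0 \<le> B \<longrightarrow>
    \<gamma> * (A * y) \<le> (1 - A) * (1 - y) \<longrightarrow> \<gamma> * (x * B) \<le> (1 - x) * (1 - B) \<longrightarrow>
    \<gamma>\<^sup>2 * (x * y) \<le> (1 - x) * (1 - y) \<longrightarrow>
    (\<alpha> * x + A) * (\<beta> * y + B) \<le> 1 - \<kappa> * (x + y)"
proof -
  have ab: "\<alpha> < \<gamma>" "\<beta> < \<gamma>" "1 < \<gamma>"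
    using assms by (auto simp: less_1_mult)
  \<comment> \<open>A common lower bound for the coefficients of the first two summands; the factor
    \<open>1 - 1 / \<gamma>\<close> is the loss in \<open>gap\<close>.\<close>
  define \<mu> where "\<mu> = (1 - 1 / \<gamma>) * min (\<alpha> * (\<beta> - 1)) (\<beta> * (\<alpha> - 1))"
  have \<mu>: "0 < \<mu>" unfolding \<mu>_def using assms ab by simp
  \<comment> \<open>If \<open>x\<close> and \<open>y\<close> are at most 3/4, then
    \<open>1 - x\<close> and \<open>1 - y\<close> are at least 1/4 and \<open>z\<close> at least
    1/16, which gives 1/64. The value 1/8 serves \<open>apart\<close>, where the square is at least
    1/4.\<close>
  define \<nu> where "\<nu> = min (\<mu> / 64) (1 / 8)"
  have \<nu>: "0 < \<nu>" unfolding \<nu>_def using \<mu> by simp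
  have main: "(\<alpha> * x + A) * (\<beta> * y + B) \<le> 1 - \<nu> / \<gamma>\<^sup>2 * (x + y)"
    if xy: "0 \<le> x" "x \<le> 1" "0 \<le> y" "y \<le> 1" and AB: "0 \<le> A" "0 \<le> B"
      and KA: "\<gamma> * (A * y) \<le> (1 - A) * (1 - y)" and KB: "\<gamma> * (x * B) \<le> (1 - x) * (1 - B)"
      and H: "\<gamma>\<^sup>2 * (x * y) \<le> (1 - x) * (1 - y)" for x y A B
  proof -
    define z where "z = (1 - x) * (1 - y)"
    have z: "0 \<le> z" unfolding z_def using xy by simp
    have gap: "(1 - 1 / \<gamma>) * z \<le> z - t * (x * y)" if "t \<le> \<gamma>" for t
    proof -
      have "\<gamma> * (t * (x * y)) \<le> \<gamma> * (\<gamma> * (x * y))"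
        using that xy ab by (intro mult_left_mono mult_right_mono) auto
      also have "\<dots> \<le> z" using H unfolding z_def by (simp add: power2_eq_square mult_ac)
      finally have "t * (x * y) \<le> z / \<gamma>" using ab by (simp add: field_simps)
      then show ?thesis by (simp add: algebra_simps)
    qed
    have gaps: "(1 - 1 / \<gamma>) * z \<le> z - \<beta> * (x * y)" "(1 - 1 / \<gamma>) * z \<le> z - \<alpha> * (x * y)"
      using gap ab by auto
    define dx dy where "dx = 1 + (\<gamma> - 1) * x" and "dy = 1 + (\<gamma> - 1) * y"
    have d: "1 \<le> dx" "1 \<le> dy" "dx \<le> \<gamma>" "dy \<le> \<gamma>"
    proof -
      show "1 \<le> dx" "1 \<le> dy" unfolding dx_def dy_def using xy ab by auto
      have "(\<gamma> - 1) * x \<le> (\<gamma> - 1) * 1" "(\<gamma> - 1) * y \<le> (\<gamma> - 1) * 1"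
        using xy ab by (intro mult_left_mono; simp)+
      then show "dx \<le> \<gamma>" "dy \<le> \<gamma>" unfolding dx_def dy_def by auto
    qed
    define N where "N = dx * dy - (\<alpha> * x * dy + (1 - y)) * (\<beta> * y * dx + (1 - x))"
    have "N = \<alpha> * (\<beta> - 1) * (x * (1 - y)) * (z - \<beta> * (x * y))
      + \<beta> * (\<alpha> - 1) * (y * (1 - x)) * (z - \<alpha> * (x * y))
      + \<gamma> * (x - y)\<^sup>2
      + (1 + \<gamma>) * ((\<alpha> - 1) * (\<beta> - 1)) * (x * y * z)
      + (\<gamma> - 1) * (x * y) * (z - \<gamma>\<^sup>2 * (x * y))"
      unfolding N_def dx_def dy_def z_def \<gamma>_def by (rule two_point_identity)
    moreover have "\<mu> * (x * (1 - y) * z) \<le> \<alpha> * (\<beta> - 1) * (x * (1 - y)) * (z - \<beta> * (x * y))"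
    proof -
      have "\<mu> * (x * (1 - y) * z) \<le> ((1 - 1 / \<gamma>) * (\<alpha> * (\<beta> - 1))) * (x * (1 - y) * z)"
        unfolding \<mu>_def using xy z ab by (intro mult_right_mono mult_left_mono) auto
      also have "\<dots> = (\<alpha> * (\<beta> - 1) * (x * (1 - y))) * ((1 - 1 / \<gamma>) * z)"
        by (simp add: mult_ac)
      also have "\<dots> \<le> (\<alpha> * (\<beta> - 1) * (x * (1 - y))) * (z - \<beta> * (x * y))"
        using xy assms gaps by (intro mult_left_mono) auto
      finally show ?thesis .
    qed
    moreover have "\<mu> * (y * (1 - x) * z) \<le> \<beta> * (\<alpha> - 1) * (y * (1 - x)) * (z - \<alpha> * (x * y))"
    proof -
      have "\<mu> * (y * (1 - x) * z) \<le> ((1 - 1 / \<gamma>) * (\<beta> * (\<alpha> - 1))) * (y * (1 - x) * z)"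
        unfolding \<mu>_def using xy z ab by (intro mult_right_mono mult_left_mono) auto
      also have "\<dots> = (\<beta> * (\<alpha> - 1) * (y * (1 - x))) * ((1 - 1 / \<gamma>) * z)"
        by (simp add: mult_ac)
      also have "\<dots> \<le> (\<beta> * (\<alpha> - 1) * (y * (1 - x))) * (z - \<alpha> * (x * y))"
        using xy assms gaps by (intro mult_left_mono) auto
      finally show ?thesis .
    qed
    moreover have "1 * (x - y)\<^sup>2 \<le> \<gamma> * (x - y)\<^sup>2"
      using ab by (intro mult_right_mono) auto
    moreover have "0 \<le> (1 + \<gamma>) * ((\<alpha> - 1) * (\<beta> - 1)) * (x * y * z)"
      using xy z ab assms by simp
    moreover have "0 \<le> (\<gamma> - 1) * (x * y) * (z - \<gamma>\<^sup>2 * (x * y))"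
      using xy ab H unfolding z_def by simp
    ultimately have N1: "\<mu> * (x * (1 - y) * z) + \<mu> * (y * (1 - x) * z) + (x - y)\<^sup>2 \<le> N"
      by linarith
    have apart: "\<nu> * (u + v) \<le> (u - v)\<^sup>2"
      if "3 / 4 \<le> u" "u \<le> 1" "0 \<le> v" "u * v \<le> (1 - u) * (1 - v)" for u v :: real
    proof -
      have "u + v \<le> 1" using that(4) by (simp add: algebra_simps)
      with that have "1 / 2 \<le> u - v" by simp
      then have "(1 / 2)\<^sup>2 \<le> (u - v)\<^sup>2" by (intro power_mono) auto
      moreover have "\<nu> * (u + v) \<le> 1 / 8 * 1"
        using that \<open>u + v \<le> 1\<close> \<nu> by (intro mult_mono) (auto simp: \<nu>_def)
      ultimately show ?thesis by (simp add: power2_eq_square)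
    qed
    have "1 * (x * y) \<le> \<gamma>\<^sup>2 * (x * y)"
      using ab xy by (intro mult_right_mono) (auto simp: one_le_power)
    then have H1: "x * y \<le> (1 - x) * (1 - y)" using H by simp
    have N2: "\<nu> * (x + y) \<le> N"
    proof -
      consider "3 / 4 \<le> x" | "3 / 4 \<le> y" | "x \<le> 3 / 4" "y \<le> 3 / 4" by linarith
      then show ?thesis
      proof cases
        case 1
        have "0 \<le> \<mu> * (x * (1 - y) * z)" "0 \<le> \<mu> * (y * (1 - x) * z)"
          using \<mu> xy z by auto
        with apart[OF 1 xy(2,3) H1] N1 show ?thesis by linarith
      next
        case 2
        have "0 \<le> \<mu> * (x * (1 - y) * z)" "0 \<le> \<mu> * (y * (1 - x) * z)"
          using \<mu> xy z by auto
        moreover have "\<nu> * (y + x) \<le> (y - x)\<^sup>2"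
          using H1 by (intro apart[OF 2 xy(4,1)]) (simp add: mult_ac)
        ultimately show ?thesis using N1 by (simp add: power2_commute add.commute)
      next
        case 3
        have "1 / 4 * (1 / 4) \<le> z"
          unfolding z_def using 3 by (intro mult_mono) auto
        then have z16: "1 / 16 \<le> z" by simp
        have "x * (1 / 4) * (1 / 16) \<le> x * (1 - y) * z" "y * (1 / 4) * (1 / 16) \<le> y * (1 - x) * z"
          using 3 xy z16 by (intro mult_mono; simp)+
        then have "\<mu> * (x * (1 / 4) * (1 / 16)) \<le> \<mu> * (x * (1 - y) * z)"
            "\<mu> * (y * (1 / 4) * (1 / 16)) \<le> \<mu> * (y * (1 - x) * z)"
          using \<mu> by (intro mult_left_mono; simp)+
        moreover have "\<nu> * (x + y) \<le> \<mu> / 64 * (x + y)"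
          using xy by (intro mult_right_mono) (auto simp: \<nu>_def)
        moreover have "\<mu> / 64 * (x + y)
            = \<mu> * (x * (1 / 4) * (1 / 16)) + \<mu> * (y * (1 / 4) * (1 / 16))"
          by (simp add: algebra_simps)
        moreover have "0 \<le> (x - y)\<^sup>2" by simp
        ultimately show ?thesis using N1 by linarith
      qed
    qed
    \<comment> \<open>Undoing the multiplication by \<open>dx * dy\<close> costs at most
      \<open>\<gamma>\<^sup>2\<close>, hence the constant
      \<open>\<nu> / \<gamma>\<^sup>2\<close>.\<close>
    have "dx * dy \<le> \<gamma>\<^sup>2"
      unfolding power2_eq_square using d by (intro mult_mono) auto
    then have "\<nu> * (x + y) / \<gamma>\<^sup>2 * (dx * dy) \<le> \<nu> * (x + y) / \<gamma>\<^sup>2 * \<gamma>\<^sup>2"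
      using \<nu> xy by (intro mult_left_mono) auto
    also have "\<dots> = \<nu> * (x + y)" using ab by simp
    finally have N3: "\<nu> / \<gamma>\<^sup>2 * (x + y) * (dx * dy) \<le> N" using N2 by simp
    have "A * dy \<le> 1 - y" "B * dx \<le> 1 - x"
      using KA KB unfolding dx_def dy_def by (simp_all add: algebra_simps)
    then have "(\<alpha> * x * dy + A * dy) * (\<beta> * y * dx + B * dx)
        \<le> (\<alpha> * x * dy + (1 - y)) * (\<beta> * y * dx + (1 - x))"
      using xy d AB assms by (intro mult_mono add_mono) auto
    also have "\<dots> = dx * dy - N" unfolding N_def by simp
    also have "\<dots> \<le> (1 - \<nu> / \<gamma>\<^sup>2 * (x + y)) * (dx * dy)"
      using N3 by (simp add: algebra_simps)
    finally have "((\<alpha> * x + A) * (\<beta> * y + B)) * (dx * dy)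
        \<le> (1 - \<nu> / \<gamma>\<^sup>2 * (x + y)) * (dx * dy)"
      by (simp add: algebra_simps)
    moreover have "0 < dx * dy" using d by simp
    ultimately show ?thesis by (rule mult_right_le_imp_le)
  qed
  have "0 < \<nu> / \<gamma>\<^sup>2" using \<nu> ab by simp
  with main show ?thesis by blast
qed

section \<open>Stability for up-sets and uniform weights\<close>

text \<open>Averaging over \<open>i\<close> gives at most the value at the upper section. This
  carries smallness of a lower section at \<open>j\<close> from \<open>section1 i A\<close> back to
  \<open>A\<close>.\<close>

lemma section0_insert_le:
  assumes "finite I" "i \<notin> I" "i \<noteq> j" "upclosed A" "0 \<le> p" "p \<le> 1"
  shows "prod_measure (insert i I) (\<lambda>_. p) (section0 j A)
    \<le> prod_measure I (\<lambda>_. p) (section0 j (section1 i A))"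
proof -
  let ?m = "prod_measure I (\<lambda>_. p)"
  have "section0 i (section0 j A) \<subseteq> section1 i (section0 j A)"
    by (rule section0_subset_section1[OF upclosed_sections(1)[OF assms(4)]])
  then have "?m (section0 i (section0 j A)) \<le> ?m (section1 i (section0 j A))"
    using assms by (intro prod_measure_mono) auto
  then have "(1 - p) * ?m (section0 i (section0 j A)) + p * ?m (section1 i (section0 j A))
      \<le> (1 - p) * ?m (section1 i (section0 j A)) + p * ?m (section1 i (section0 j A))"
    using assms by (intro add_right_mono mult_left_mono) auto
  also have "\<dots> = ?m (section0 j (section1 i A))"
    using section_commute[OF assms(3)] by (simp add: algebra_simps)
  finally show ?thesis using assms by (simp add: prod_measure_insert)
qed

text \<open>One tiny lower section suffices for the two-point condition, provided the other is not
  almost everything; the last hypothesis ensures this.\<close>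

lemma small_section:
  fixes \<gamma> t x y :: real
  assumes "1 < \<gamma>" "0 < t" "t \<le> 1" "0 \<le> x" "0 \<le> y" "y \<le> 1"
    and "x \<le> t / (8 * \<gamma>\<^sup>2)" "t / 2 \<le> x + (1 - y)"
  shows "\<gamma>\<^sup>2 * (x * y) \<le> (1 - x) * (1 - y)"
proof -
  have g: "1 \<le> \<gamma>\<^sup>2" using assms by (simp add: one_le_power)
  have gx: "\<gamma>\<^sup>2 * x \<le> t / 8" using assms by (simp add: field_simps)
  have "1 * x \<le> \<gamma>\<^sup>2 * x" using g assms by (intro mult_right_mono) auto
  then have x: "x \<le> t / 8" using gx by simp
  have "\<gamma>\<^sup>2 * (x * y) \<le> \<gamma>\<^sup>2 * (x * 1)"
    using assms by (intro mult_left_mono) auto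
  \<comment> \<open>Since \<open>x \<le> t / 8\<close>, the last hypothesis leaves
    \<open>1 - y \<ge> t / 2 - t / 8\<close>.\<close>
  also have "\<dots> \<le> 1 / 2 * (t * 3 / 8)" using gx assms by simp
  also have "\<dots> \<le> (1 - x) * (1 - y)"
    using x assms by (intro mult_mono) auto
  finally show ?thesis .
qed

text \<open>Small lower sections at \<open>j\<close> mean that few members of \<open>A\<close> and
  \<open>B\<close> avoid \<open>j\<close>. The sign of \<open>\<epsilon>\<close> is left open: a
  negative value would contradict the conclusion, so the sharp bound \<open>p * q\<close> on the
  product is included.\<close>

lemma uniform_stability:
  fixes p q :: real
  assumes p: "0 < p" "p < 1/2" and q: "0 < q" "q < 1/2"
  obtains \<kappa> \<epsilon>0 where "0 < \<kappa>" "0 < \<epsilon>0"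
    "\<And>(I :: 'a set) A B \<epsilon>. \<lbrakk>finite I; upclosed A; upclosed B; cross_intersecting A B; \<epsilon> \<le> \<epsilon>0;
      (1 - \<epsilon>) * (p * q) \<le> prod_measure I (\<lambda>_. p) A * prod_measure I (\<lambda>_. q) B\<rbrakk> \<Longrightarrow>
      \<exists>j\<in>I. \<kappa> * (prod_measure I (\<lambda>_. p) (section0 j A) + prod_measure I (\<lambda>_. q) (section0 j B)) \<le> \<epsilon>"
proof -
  define \<alpha> \<beta> \<gamma> where "\<alpha> = (1 - p) / p" and "\<beta> = (1 - q) / q" and "\<gamma> = \<alpha> * \<beta>"
  have \<alpha>\<beta>: "1 < \<alpha>" "1 < \<beta>" unfolding \<alpha>_def \<beta>_def using p q by (auto simp: field_simps)
  have \<gamma>: "1 < \<gamma>" unfolding \<gamma>_def using \<alpha>\<beta> by (simp add: less_1_mult)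
  obtain \<kappa> where \<kappa>: "0 < \<kappa>" and two_point:
    "\<And>x y A B. \<lbrakk>0 \<le> x; x \<le> 1; 0 \<le> y; y \<le> 1; 0 \<le> A; 0 \<le> B;
      \<gamma> * (A * y) \<le> (1 - A) * (1 - y); \<gamma> * (x * B) \<le> (1 - x) * (1 - B);
      \<gamma>\<^sup>2 * (x * y) \<le> (1 - x) * (1 - y)\<rbrakk> \<Longrightarrow> (\<alpha> * x + A) * (\<beta> * y + B) \<le> 1 - \<kappa> * (x + y)"
    using two_point_bound[OF \<alpha>\<beta>] unfolding \<gamma>_def by blast
  let ?P = "\<lambda>(I :: 'a set) A. prod_measure I (\<lambda>_. p) A"
  let ?Q = "\<lambda>(I :: 'a set) A. prod_measure I (\<lambda>_. q) A"
  have pr: "0 \<le> ?P I A" "?P I A \<le> 1" "0 \<le> ?Q I A" "?Q I A \<le> 1" if "finite I" for I A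
    using that p q by (auto intro!: prod_measure_nonneg prod_measure_le_1)
  have K: "\<gamma> * (?P I A * ?Q I B) \<le> (1 - ?P I A) * (1 - ?Q I B)"
    if "finite I" "cross_intersecting A B" for I A B
    unfolding \<gamma>_def \<alpha>_def \<beta>_def using correlation_bound[of p q I A B] that p q by simp
  have split: "?P I A = p * (\<alpha> * ?P I (section0 j A) + ?P I (section1 j A))"
      "?Q I A = q * (\<beta> * ?Q I (section0 j A) + ?Q I (section1 j A))"
    if "finite I" "j \<in> I" for I A j
    using prod_measure_split[OF that, of "\<lambda>_. p" A] prod_measure_split[OF that, of "\<lambda>_. q" A] p q
    unfolding \<alpha>_def \<beta>_def distrib_left by simp_all
  have direct: "\<kappa> * (?P I (section0 j A) + ?Q I (section0 j B)) \<le> \<epsilon>"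
    if I: "finite I" "j \<in> I" and AB: "cross_intersecting A B"
      and large: "(1 - \<epsilon>) * (p * q) \<le> ?P I A * ?Q I B"
      and small: "\<gamma>\<^sup>2 * (?P I (section0 j A) * ?Q I (section0 j B))
        \<le> (1 - ?P I (section0 j A)) * (1 - ?Q I (section0 j B))" for I A B j \<epsilon>
  proof -
    let ?x = "?P I (section0 j A)" and ?y = "?Q I (section0 j B)"
    have "(1 - \<epsilon>) * (p * q)
        \<le> p * q * ((\<alpha> * ?x + ?P I (section1 j A)) * (\<beta> * ?y + ?Q I (section1 j B)))"
      using large unfolding split(1)[OF I, of A] split(2)[OF I, of B] by (simp add: mult_ac)
    also have "\<dots> \<le> p * q * (1 - \<kappa> * (?x + ?y))"
      using p q pr[OF I(1)] small K[OF I(1)] cross_intersecting_sections[OF AB]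
      by (intro mult_left_mono two_point) auto
    finally have "p * q * (1 - \<epsilon>) \<le> p * q * (1 - \<kappa> * (?x + ?y))"
      by (simp add: mult_ac)
    then show ?thesis using p q by simp
  qed
  \<comment> \<open>The threshold of \<open>small_section\<close> for
    \<open>t = p * q\<close>.\<close>
  define \<delta> where "\<delta> = p * q / (8 * \<gamma>\<^sup>2)"
  have pq: "0 < p * q" "p * q \<le> 1" using p q by (auto intro: mult_le_one)
  have \<delta>: "0 < \<delta>" unfolding \<delta>_def using pq \<gamma> by simp
  have close: "\<gamma>\<^sup>2 * (?P I (section0 j A) * ?Q I (section0 j B))
        \<le> (1 - ?P I (section0 j A)) * (1 - ?Q I (section0 j B))"
    if I: "finite I" "j \<in> I" and AB: "cross_intersecting A B"
      and large: "(1 - \<epsilon>) * (p * q) \<le> ?P I A * ?Q I B" and "\<epsilon> \<le> 1 / 2"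
      and small: "?P I (section0 j A) \<le> \<delta> \<or> ?Q I (section0 j B) \<le> \<delta>" for I A B j \<epsilon>
  proof -
    let ?x = "?P I (section0 j A)" and ?y = "?Q I (section0 j B)"
    have "1 / 2 * (p * q) \<le> (1 - \<epsilon>) * (p * q)"
      using pq that by (intro mult_right_mono) auto
    then have half: "p * q / 2 \<le> ?P I A * ?Q I B" using large by simp
    \<comment> \<open>As \<open>\<gamma> > 1\<close>, the correlation bound yields
      \<open>a * b \<le> (1 - a) * (1 - b)\<close>, that is, \<open>a + b \<le> 1\<close>.\<close>
    have disj: "?P I C + ?Q I D \<le> 1" if "cross_intersecting C D" for C D
    proof -
      have "1 * (?P I C * ?Q I D) \<le> \<gamma> * (?P I C * ?Q I D)"
        using \<gamma> pr[OF I(1)] by (intro mult_right_mono) auto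
      then show ?thesis using K[OF I(1) that] by (simp add: algebra_simps)
    qed
    have upper: "?P I A \<le> ?x + ?P I (section1 j A)" "?Q I B \<le> ?y + ?Q I (section1 j B)"
    proof -
      have "(1 - p) * ?x \<le> 1 * ?x" "p * ?P I (section1 j A) \<le> 1 * ?P I (section1 j A)"
        "(1 - q) * ?y \<le> 1 * ?y" "q * ?Q I (section1 j B) \<le> 1 * ?Q I (section1 j B)"
        using p q pr[OF I(1)] by (intro mult_right_mono; simp)+
      then show "?P I A \<le> ?x + ?P I (section1 j A)" "?Q I B \<le> ?y + ?Q I (section1 j B)"
        using prod_measure_split[OF I, of "\<lambda>_. p" A] prod_measure_split[OF I, of "\<lambda>_. q" B]
        by linarith+
    qed
    have "?P I A * ?Q I B \<le> ?P I A" "?P I A * ?Q I B \<le> ?Q I B"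
      using pr[OF I(1)] by (auto simp: mult_left_le mult_left_le_one_le)
    then have bounds: "p * q / 2 \<le> ?x + (1 - ?y)" "p * q / 2 \<le> ?y + (1 - ?x)"
      using half upper disj[OF cross_intersecting_sections(2)[OF AB, of j]]
        disj[OF cross_intersecting_sections(3)[OF AB, of j]] by linarith+
    from small show ?thesis
    proof
      assume "?x \<le> \<delta>"
      then show ?thesis
        using small_section[OF \<gamma> pq, of ?x ?y] pr[OF I(1)] bounds unfolding \<delta>_def by simp
    next
      assume "?y \<le> \<delta>"
      then have "\<gamma>\<^sup>2 * (?y * ?x) \<le> (1 - ?y) * (1 - ?x)"
        using small_section[OF \<gamma> pq, of ?y ?x] pr[OF I(1)] bounds unfolding \<delta>_def by simp
      then show ?thesis by (simp add: mult_ac)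
    qed
  qed
  \<comment> \<open>The bound 1/2 is what \<open>close\<close> needs;
    \<open>\<kappa> * \<delta>\<close> turns the conclusion of the induction hypothesis into lower
    sections of measure at most \<open>\<delta>\<close>.\<close>
  define \<epsilon>0 where "\<epsilon>0 = min (1 / 2) (\<kappa> * \<delta>)"
  have \<epsilon>0: "0 < \<epsilon>0" unfolding \<epsilon>0_def using \<kappa> \<delta> by simp
  have main: "\<exists>j\<in>I. \<kappa> * (?P I (section0 j A) + ?Q I (section0 j B)) \<le> \<epsilon>"
    if "finite I" "upclosed A" "upclosed B" "cross_intersecting A B" and \<epsilon>: "\<epsilon> \<le> \<epsilon>0"
      and "(1 - \<epsilon>) * (p * q) \<le> ?P I A * ?Q I B" for I A B \<epsilon>
    using that(1-4,6)
  proof (induction I arbitrary: A B rule: finite_induct)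
    case empty
    have "0 < (1 - \<epsilon>) * (p * q)" using pq \<epsilon> unfolding \<epsilon>0_def by simp
    moreover have "{} \<notin> A \<or> {} \<notin> B"
      using empty unfolding cross_intersecting_def by blast
    ultimately show ?case using empty by (auto simp: prod_measure_empty)
  next
    case (insert i I)
    let ?J = "insert i I"
    have J: "finite ?J" "i \<in> ?J" using insert by auto
    let ?x = "?P I (section0 i A)" and ?A = "?P I (section1 i A)"
    let ?y = "?Q I (section0 i B)" and ?B = "?Q I (section1 i B)"
    have sec: "?P ?J (section0 i A) = ?x" "?Q ?J (section0 i B) = ?y"
      using insert by (simp_all add: prod_measure_insert section0_idem algebra_simps)
    show ?case
    proof (cases "\<gamma>\<^sup>2 * (?x * ?y) \<le> (1 - ?x) * (1 - ?y)")
      case True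
      then have "\<kappa> * (?P ?J (section0 i A) + ?Q ?J (section0 i B)) \<le> \<epsilon>"
        using insert.prems by (intro direct[OF J]) (auto simp: sec)
      then show ?thesis by blast
    next
      case False
      note cross = cross_intersecting_sections[OF insert.prems(3), of i]
      have "?B \<le> \<gamma> * ?y"
        using False nonreducible_section[OF \<gamma>, of ?x ?y ?B] pr[OF insert(1)]
          K[OF insert(1) cross(2)] by force
      moreover have "?A \<le> \<gamma> * ?x"
        using False nonreducible_section[OF \<gamma>, of ?y ?x ?A] pr[OF insert(1)]
          K[OF insert(1) cross(3)] by (force simp: mult_ac)
      moreover have "?x \<le> ?A" "?y \<le> ?B"
        using p q insert.hyps section0_subset_section1[OF insert.prems(1), of i]
          section0_subset_section1[OF insert.prems(2), of i]
        by (auto intro!: prod_measure_mono)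
      ultimately have "(\<alpha> * ?x + ?A) * (\<beta> * ?y + ?B)
          \<le> (1 + \<alpha>) * (1 + \<beta>) * max (?x * ?B) (?A * ?y)"
        using \<alpha>\<beta> pr[OF insert(1)] unfolding \<gamma>_def by (intro reducible_step) auto
      then have "p * q * ((\<alpha> * ?x + ?A) * (\<beta> * ?y + ?B))
          \<le> p * q * ((1 + \<alpha>) * (1 + \<beta>) * max (?x * ?B) (?A * ?y))"
        using pq by (intro mult_left_mono) auto
      also have "\<dots> = (p * (1 + \<alpha>)) * (q * (1 + \<beta>)) * max (?x * ?B) (?A * ?y)"
        by (simp add: mult_ac)
      also have "\<dots> = max (?x * ?B) (?A * ?y)"
        unfolding \<alpha>_def \<beta>_def using p q by (simp add: field_simps)
      also have "p * q * ((\<alpha> * ?x + ?A) * (\<beta> * ?y + ?B)) = ?P ?J A * ?Q ?J B"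
      proof -
        have "p * (\<alpha> * ?x + ?A) = ?P ?J A" "q * (\<beta> * ?y + ?B) = ?Q ?J B"
          unfolding prod_measure_insert[OF insert(1,2)] \<alpha>_def \<beta>_def
          using p q by (simp_all add: field_simps)
        then show ?thesis by (metis mult.assoc mult.left_commute)
      qed
      finally have "(1 - \<epsilon>) * (p * q) \<le> ?x * ?B \<or> (1 - \<epsilon>) * (p * q) \<le> ?A * ?y"
        using insert.prems by linarith
      \<comment> \<open>Only the family that passed to its upper section at \<open>i\<close> is
        controlled, because \<open>section0_insert_le\<close> compares with
        \<open>section1 i\<close>.\<close>
      then have "\<exists>j\<in>I. ?P ?J (section0 j A) \<le> \<delta> \<or> ?Q ?J (section0 j B) \<le> \<delta>"
      proof
        assume large: "(1 - \<epsilon>) * (p * q) \<le> ?x * ?B"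
        then obtain j where j: "j \<in> I" and "\<kappa> * (?P I (section0 j (section0 i A))
            + ?Q I (section0 j (section1 i B))) \<le> \<epsilon>"
          using insert.IH[OF upclosed_sections(1)[OF insert.prems(1)]
            upclosed_sections(2)[OF insert.prems(2)] cross(2) large] by (elim bexE)
        then have "\<kappa> * ?P I (section0 j (section0 i A)) + \<kappa> * ?Q I (section0 j (section1 i B)) \<le> \<kappa> * \<delta>"
          using \<epsilon> unfolding \<epsilon>0_def by (simp add: distrib_left)
        moreover have "0 \<le> \<kappa> * ?P I (section0 j (section0 i A))"
          using \<kappa> pr[OF insert(1)] by simp
        ultimately have "\<kappa> * ?Q I (section0 j (section1 i B)) \<le> \<kappa> * \<delta>"
          by linarith
        then have "?Q I (section0 j (section1 i B)) \<le> \<delta>"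
          using \<kappa> by simp
        moreover have "?Q ?J (section0 j B) \<le> ?Q I (section0 j (section1 i B))"
          using j insert q by (intro section0_insert_le) auto
        ultimately show ?thesis using j by force
      next
        assume large: "(1 - \<epsilon>) * (p * q) \<le> ?A * ?y"
        then obtain j where j: "j \<in> I" and "\<kappa> * (?P I (section0 j (section1 i A))
            + ?Q I (section0 j (section0 i B))) \<le> \<epsilon>"
          using insert.IH[OF upclosed_sections(2)[OF insert.prems(1)]
            upclosed_sections(1)[OF insert.prems(2)] cross(3) large] by (elim bexE)
        then have "\<kappa> * ?P I (section0 j (section1 i A)) + \<kappa> * ?Q I (section0 j (section0 i B)) \<le> \<kappa> * \<delta>"
          using \<epsilon> unfolding \<epsilon>0_def by (simp add: distrib_left)
        moreover have "0 \<le> \<kappa> * ?Q I (section0 j (section0 i B))"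
          using \<kappa> pr[OF insert(1)] by simp
        ultimately have "\<kappa> * ?P I (section0 j (section1 i A)) \<le> \<kappa> * \<delta>"
          by linarith
        then have "?P I (section0 j (section1 i A)) \<le> \<delta>"
          using \<kappa> by simp
        moreover have "?P ?J (section0 j A) \<le> ?P I (section0 j (section1 i A))"
          using j insert p by (intro section0_insert_le) auto
        ultimately show ?thesis using j by force
      qed
      then obtain j where j: "j \<in> ?J"
          and "?P ?J (section0 j A) \<le> \<delta> \<or> ?Q ?J (section0 j B) \<le> \<delta>"
        by blast
      \<comment> \<open>The induction hypothesis supplied only \<open>j\<close>. The estimate comes
        afresh from \<open>direct\<close> for the full families, with the same
        \<open>\<kappa>\<close> and \<open>\<epsilon>\<close>.\<close>
      then have "\<kappa> * (?P ?J (section0 j A) + ?Q ?J (section0 j B)) \<le> \<epsilon>"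
        using insert.prems \<epsilon> unfolding \<epsilon>0_def
        by (intro direct[OF J(1) j] close[OF J(1) j, where \<epsilon> = \<epsilon>]) auto
      then show ?thesis using j by blast
    qed
  qed
  show ?thesis by (rule that[OF \<kappa> \<epsilon>0 main])
qed

section \<open>General families and weights\<close>

definition up_closure :: "'a set set \<Rightarrow> 'a set set" where
  "up_closure A = {T. \<exists>S\<in>A. S \<subseteq> T}"

lemma upclosed_up_closure: "upclosed (up_closure A)"
  unfolding upclosed_def up_closure_def by blast

lemma subset_up_closure: "A \<subseteq> up_closure A"
  unfolding up_closure_def by blast

lemma cross_intersecting_up_closure:
  assumes "cross_intersecting A B"
  shows "cross_intersecting (up_closure A) (up_closure B)"
  unfolding cross_intersecting_def
proof (intro ballI)
  fix S T assume "S \<in> up_closure A" "T \<in> up_closure B"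
  then obtain S' T' where "S' \<in> A" "S' \<subseteq> S" "T' \<in> B" "T' \<subseteq> T"
    unfolding up_closure_def by blast
  moreover from this have "S' \<inter> T' \<noteq> {}"
    using assms unfolding cross_intersecting_def by blast
  ultimately show "S \<inter> T \<noteq> {}" by blast
qed

lemma prod_measure_Un_disjoint:
  assumes "finite I" "A \<inter> B = {}"
  shows "prod_measure I w (A \<union> B) = prod_measure I w A + prod_measure I w B"
proof -
  have "Pow I \<inter> (A \<union> B) = (Pow I \<inter> A) \<union> (Pow I \<inter> B)" by blast
  moreover have "(Pow I \<inter> A) \<inter> (Pow I \<inter> B) = {}" using assms by blast
  ultimately show ?thesis
    unfolding prod_measure_def using assms by (simp add: sum.union_disjoint)
qed

text \<open>The part of \<open>A\<close> outside the star has measure at most \<open>x\<close>, so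
  the part inside has at least the measure of \<open>A\<close> minus \<open>x\<close>, while the
  star itself has measure \<open>v j \<le> w j\<close>. The up-closure permits replacing
  \<open>v\<close> by \<open>w\<close> in the lower section.\<close>

lemma star_distance:
  fixes I :: "'a set" and A :: "'a set set" and j :: 'a and v w :: "'a \<Rightarrow> real"
  assumes I: "finite I" "j \<in> I" and w: "\<forall>i\<in>I. 0 \<le> v i \<and> v i \<le> w i \<and> w i \<le> 1"
  defines "S \<equiv> {T. j \<in> T}" and "x \<equiv> prod_measure I w (section0 j (up_closure A))"
  shows "prod_measure I v A \<le> w j + x"
    and "prod_measure I v (sym_diff A S) \<le> w j - prod_measure I v A + 2 * x"
proof -
  let ?m = "prod_measure I v"
  have v: "\<forall>i\<in>I. 0 \<le> v i \<and> v i \<le> 1" using w by force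
  have "section0 j S = {}" "section1 j S = UNIV"
    unfolding S_def section0_def section1_def by auto
  then have star: "?m S = v j"
    using prod_measure_split[OF I, of v S] prod_measure_UNIV[OF I(1), of v]
    by (simp add: prod_measure_def)
  have "section1 j (A - S) = {}"
    unfolding S_def section1_def by auto
  then have "?m (A - S) = (1 - v j) * ?m (section0 j (A - S))"
    using prod_measure_split[OF I, of v "A - S"] by (simp add: prod_measure_def)
  also have "\<dots> \<le> 1 * ?m (section0 j (A - S))"
    using v I prod_measure_nonneg[OF I(1) v] by (intro mult_right_mono) auto
  also have "\<dots> \<le> ?m (section0 j (up_closure A))"
  proof -
    have "section0 j (A - S) \<subseteq> section0 j (up_closure A)"
      using subset_up_closure[of A] unfolding section0_def by blast
    then show ?thesis using prod_measure_mono[OF I(1) v] by (simp add: le_infI2)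
  qed
  also have "\<dots> \<le> x"
    unfolding x_def using w I upclosed_sections(1)[OF upclosed_up_closure]
    by (intro prod_measure_weight_mono)
  finally have out: "?m (A - S) \<le> x" .
  have A: "?m A = ?m (A \<inter> S) + ?m (A - S)"
  proof -
    have "(A \<inter> S) \<union> (A - S) = A" "(A \<inter> S) \<inter> (A - S) = {}" by blast+
    then show ?thesis using prod_measure_Un_disjoint[OF I(1), of "A \<inter> S" "A - S" v] by simp
  qed
  have S: "?m S = ?m (A \<inter> S) + ?m (S - A)"
  proof -
    have "(A \<inter> S) \<union> (S - A) = S" "(A \<inter> S) \<inter> (S - A) = {}" by blast+
    then show ?thesis using prod_measure_Un_disjoint[OF I(1), of "A \<inter> S" "S - A" v] by simp
  qed
  have D: "?m (sym_diff A S) = ?m (A - S) + ?m (S - A)"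
    by (intro prod_measure_Un_disjoint[OF I(1)]) blast
  have vj: "v j \<le> w j" using w I by blast
  show "?m A \<le> w j + x" using A S star out vj prod_measure_nonneg[OF I(1) v, of "S - A"]
    by linarith
  show "?m (sym_diff A S) \<le> w j - ?m A + 2 * x" using A S D star out vj by linarith
qed

lemma biased_measure_eq:
  assumes "A \<subseteq> Pow {1..n}"
  shows "biased_measure n w A = prod_measure {1..n} w A"
  unfolding biased_measure_def prod_measure_def using assms by (simp add: Int_absorb1)

lemma biased_measure_sym_diff_star:
  assumes "A \<subseteq> Pow {1..n}"
  shows "biased_measure n w (sym_diff A (star n j)) = prod_measure {1..n} w (sym_diff A {T. j \<in> T})"
proof -
  have "sym_diff A (star n j) \<subseteq> Pow {1..n}"
    using assms unfolding star_def by blast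
  moreover have "Pow {1..n} \<inter> sym_diff A (star n j) = Pow {1..n} \<inter> sym_diff A {T. j \<in> T}"
    unfolding star_def by blast
  ultimately show ?thesis by (simp add: biased_measure_eq prod_measure_def)
qed

text \<open>If \<open>b\<close> barely exceeds \<open>q\<close>, a product near \<open>p * q\<close>
  must owe its size to \<open>a\<close>: divide by \<open>q\<close> and absorb the factors
  \<open>a \<le> 1\<close> and \<open>p \<le> 1\<close>.\<close>

lemma deficit_bound:
  fixes p q a b y \<epsilon> :: real
  assumes "0 < p" "p \<le> 1" "0 < q" "0 \<le> a" "a \<le> 1" "0 \<le> \<epsilon>" "0 \<le> y"
    and "(1 - \<epsilon>) * (p * q) \<le> a * b" "b \<le> q + y"
  shows "p - a \<le> \<epsilon> + y / q"
proof -
  have "a * b \<le> a * (q + y)" using assms by (intro mult_left_mono) auto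
  also have "\<dots> \<le> a * q + y" using assms by (simp add: distrib_left mult_left_le_one_le)
  finally have "(1 - \<epsilon>) * p * q \<le> a * q + y" using assms by (simp add: mult_ac)
  then have "(1 - \<epsilon>) * p \<le> a + y / q" using assms by (simp add: field_simps)
  moreover have "\<epsilon> * p \<le> \<epsilon>" using assms by (simp add: mult_left_le)
  ultimately show ?thesis by (simp add: algebra_simps)
qed

theorem theorem1p5:
  fixes p q :: real
  assumes "0 < q" and "q \<le> p" and "p < 1/2"
  shows "\<exists>c::real. \<forall>(n::nat) (P::nat \<Rightarrow> real) (Q::nat \<Rightarrow> real) (\<epsilon>::real) (\<A>::nat set set) (\<B>::nat set set).
    n \<ge> 1 \<longrightarrow>
    (\<forall>i\<in>{1..n}. 0 < P i \<and> P i < 1/2) \<longrightarrow>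
    (\<forall>i\<in>{1..n}. 0 < Q i \<and> Q i < 1/2) \<longrightarrow>
    P 1 = Max (P ` {1..n}) \<longrightarrow> P 1 = p \<longrightarrow>
    Q 1 = Max (Q ` {1..n}) \<longrightarrow> Q 1 = q \<longrightarrow>
    \<A> \<subseteq> Pow {1..n} \<longrightarrow> \<B> \<subseteq> Pow {1..n} \<longrightarrow>
    cross_intersecting \<A> \<B> \<longrightarrow>
    biased_measure n P \<A> * biased_measure n Q \<B> \<ge> (1 - \<epsilon>) * P 1 * Q 1 \<longrightarrow>
    (\<exists>j\<in>{1..n}. max (biased_measure n P (sym_diff \<A> (star n j)))
                     (biased_measure n Q (sym_diff \<B> (star n j))) \<le> c * \<epsilon>)"
proof (rule uniform_stability[of p q, where 'a = nat])
  show p: "0 < p" "p < 1/2" and q: "0 < q" "q < 1/2" using assms by auto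
  fix \<kappa> \<epsilon>0 :: real
  assume \<kappa>: "0 < \<kappa>" and \<epsilon>0: "0 < \<epsilon>0" and stab:
    "\<And>(I :: nat set) A B \<epsilon>. \<lbrakk>finite I; upclosed A; upclosed B; cross_intersecting A B; \<epsilon> \<le> \<epsilon>0;
      (1 - \<epsilon>) * (p * q) \<le> prod_measure I (\<lambda>_. p) A * prod_measure I (\<lambda>_. q) B\<rbrakk> \<Longrightarrow>
      \<exists>j\<in>I. \<kappa> * (prod_measure I (\<lambda>_. p) (section0 j A) + prod_measure I (\<lambda>_. q) (section0 j B)) \<le> \<epsilon>"
  \<comment> \<open>The numerator dominates all coefficients of \<open>x\<close> and
    \<open>y\<close> in the two distance bounds, and
    \<open>x + y \<le> \<epsilon> / \<kappa>\<close>. In \<open>c\<close>, the term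
    \<open>1 / \<epsilon>0\<close> covers large \<open>\<epsilon>\<close> and the 1 covers the
    \<open>\<epsilon>\<close> from \<open>deficit_bound\<close>.\<close>
  define r where "r = (1 / p + 1 / q + 2) / \<kappa>"
  define c where "c = 1 / \<epsilon>0 + 1 + r"
  have r: "0 < r" unfolding r_def using p q \<kappa> by (simp add: add_pos_pos)
  show ?thesis
  proof (intro exI[of _ c] allI impI)
    fix n P Q \<epsilon> and \<A> \<B> :: "nat set set"
    assume n: "n \<ge> 1" and P: "\<forall>i\<in>{1..n}. 0 < P i \<and> P i < (1/2 :: real)"
      and Q: "\<forall>i\<in>{1..n}. 0 < Q i \<and> Q i < (1/2 :: real)"
      and Pmax: "P 1 = Max (P ` {1..n})" "P 1 = p" and Qmax: "Q 1 = Max (Q ` {1..n})" "Q 1 = q"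
      and \<A>: "\<A> \<subseteq> Pow {1..n}" and \<B>: "\<B> \<subseteq> Pow {1..n}"
      and cross: "cross_intersecting \<A> \<B>"
      and large: "biased_measure n P \<A> * biased_measure n Q \<B> \<ge> (1 - \<epsilon>) * P 1 * Q 1"
    let ?I = "{1..n}"
    have Pp: "\<forall>i\<in>?I. 0 \<le> P i \<and> P i \<le> p \<and> p \<le> 1" and Qq: "\<forall>i\<in>?I. 0 \<le> Q i \<and> Q i \<le> q \<and> q \<le> 1"
      using P Q Pmax Qmax p q Max_ge[of "P ` ?I"] Max_ge[of "Q ` ?I"]
      by (auto simp: less_imp_le)
    have P1: "\<forall>i\<in>?I. 0 \<le> P i \<and> P i \<le> 1" and Q1: "\<forall>i\<in>?I. 0 \<le> Q i \<and> Q i \<le> 1"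
      using Pp Qq by force+
    let ?a = "prod_measure ?I P \<A>" and ?b = "prod_measure ?I Q \<B>"
    have ab: "0 \<le> ?a" "?a \<le> 1" "0 \<le> ?b" "?b \<le> 1"
      using P1 Q1 by (auto intro!: prod_measure_nonneg prod_measure_le_1)
    have large: "(1 - \<epsilon>) * (p * q) \<le> ?a * ?b"
      using large Pmax(2) Qmax(2) by (simp add: biased_measure_eq[OF \<A>] biased_measure_eq[OF \<B>] mult_ac)
    show "\<exists>j\<in>?I. max (biased_measure n P (sym_diff \<A> (star n j)))
                     (biased_measure n Q (sym_diff \<B> (star n j))) \<le> c * \<epsilon>"
      unfolding biased_measure_sym_diff_star[OF \<A>] biased_measure_sym_diff_star[OF \<B>]
    proof (cases "\<epsilon> \<le> \<epsilon>0")
      case False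
      \<comment> \<open>For large \<open>\<epsilon>\<close> the claim is trivial, since all measures
        are at most 1; any star will do.\<close>
      then have "1 \<le> 1 / \<epsilon>0 * \<epsilon>" using \<epsilon>0 by (simp add: field_simps)
      also have "\<dots> \<le> c * \<epsilon>"
        unfolding c_def using False \<epsilon>0 r by (intro mult_right_mono) auto
      finally have "1 \<le> c * \<epsilon>" .
      moreover have "prod_measure ?I P (sym_diff \<A> {T. 1 \<in> T}) \<le> 1"
          "prod_measure ?I Q (sym_diff \<B> {T. 1 \<in> T}) \<le> 1"
        using P1 Q1 by (auto intro!: prod_measure_le_1)
      ultimately have "max (prod_measure ?I P (sym_diff \<A> {T. 1 \<in> T}))
          (prod_measure ?I Q (sym_diff \<B> {T. 1 \<in> T})) \<le> c * \<epsilon>" by simp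
      then show "\<exists>j\<in>?I. max (prod_measure ?I P (sym_diff \<A> {T. j \<in> T}))
          (prod_measure ?I Q (sym_diff \<B> {T. j \<in> T})) \<le> c * \<epsilon>"
        using n by (intro bexI[of _ 1]) auto
    next
      case True
      have "?a \<le> prod_measure ?I P (up_closure \<A>)" "?b \<le> prod_measure ?I Q (up_closure \<B>)"
        using P1 Q1 subset_up_closure by (auto intro!: prod_measure_mono)
      then have "?a \<le> prod_measure ?I (\<lambda>_. p) (up_closure \<A>)"
          "?b \<le> prod_measure ?I (\<lambda>_. q) (up_closure \<B>)"
        using prod_measure_weight_mono[OF _ Pp upclosed_up_closure[of \<A>]]
          prod_measure_weight_mono[OF _ Qq upclosed_up_closure[of \<B>]] by force+
      then have "?a * ?b \<le> prod_measure ?I (\<lambda>_. p) (up_closure \<A>)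
          * prod_measure ?I (\<lambda>_. q) (up_closure \<B>)"
        using ab by (intro mult_mono) auto
      with large have "(1 - \<epsilon>) * (p * q) \<le> prod_measure ?I (\<lambda>_. p) (up_closure \<A>)
          * prod_measure ?I (\<lambda>_. q) (up_closure \<B>)"
        by linarith
      from stab[OF finite_atLeastAtMost upclosed_up_closure upclosed_up_closure
          cross_intersecting_up_closure[OF cross] True this]
      obtain j where j: "j \<in> ?I"
        and xy: "\<kappa> * (prod_measure ?I (\<lambda>_. p) (section0 j (up_closure \<A>))
          + prod_measure ?I (\<lambda>_. q) (section0 j (up_closure \<B>))) \<le> \<epsilon>"
        by (elim bexE)
      define x where "x = prod_measure ?I (\<lambda>_. p) (section0 j (up_closure \<A>))"
      define y where "y = prod_measure ?I (\<lambda>_. q) (section0 j (up_closure \<B>))"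
      have nonneg: "0 \<le> x" "0 \<le> y"
        unfolding x_def y_def using p q by (auto intro!: prod_measure_nonneg)
      have "\<kappa> * (x + y) \<le> \<epsilon>" using xy unfolding x_def y_def .
      moreover have "0 \<le> \<kappa> * (x + y)" using nonneg \<kappa> by simp
      ultimately have \<epsilon>: "0 \<le> \<epsilon>" and s: "x + y \<le> \<epsilon> / \<kappa>"
        using \<kappa> by (auto simp: field_simps)
      \<comment> \<open>With constant upper weights the bounds involve \<open>p\<close> and
        \<open>q\<close> rather than \<open>P j\<close> and \<open>Q j\<close>, so it does not
        matter which \<open>j\<close> arose.\<close>
      note dA = star_distance[OF _ j Pp, of \<A>, folded x_def]
      note dB = star_distance[OF _ j Qq, of \<B>, folded y_def]
      have "p - ?a \<le> \<epsilon> + y / q"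
        using deficit_bound[of p q ?a \<epsilon> y ?b] p q ab \<epsilon> nonneg large dB(1) by simp
      moreover have "q - ?b \<le> \<epsilon> + x / p"
        using deficit_bound[of q p ?b \<epsilon> x ?a] p q ab \<epsilon> nonneg large dA(1) by (simp add: mult_ac)
      moreover have "y / q + 2 * x \<le> r * \<epsilon>" "x / p + 2 * y \<le> r * \<epsilon>"
      proof -
        have k: "(1 / p + 1 / q + 2) * (x + y) \<le> (1 / p + 1 / q + 2) * (\<epsilon> / \<kappa>)"
          using s p q by (intro mult_left_mono) auto
        have "0 \<le> x / p" "0 \<le> x / q" "0 \<le> y / p" "0 \<le> y / q" using nonneg p q by auto
        then have "y / q + 2 * x \<le> (1 / p + 1 / q + 2) * (x + y)"
          "x / p + 2 * y \<le> (1 / p + 1 / q + 2) * (x + y)"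
          using nonneg by (auto simp: algebra_simps add_divide_distrib)
        with k show "y / q + 2 * x \<le> r * \<epsilon>" "x / p + 2 * y \<le> r * \<epsilon>"
          unfolding r_def by auto
      qed
      moreover have "\<epsilon> + r * \<epsilon> \<le> c * \<epsilon>"
        unfolding c_def using \<epsilon> \<epsilon>0 by (simp add: distrib_right)
      ultimately have "max (prod_measure ?I P (sym_diff \<A> {T. j \<in> T}))
          (prod_measure ?I Q (sym_diff \<B> {T. j \<in> T})) \<le> c * \<epsilon>"
        using dA(2) dB(2) by simp
      then show "\<exists>j\<in>?I. max (prod_measure ?I P (sym_diff \<A> {T. j \<in> T}))
          (prod_measure ?I Q (sym_diff \<B> {T. j \<in> T})) \<le> c * \<epsilon>"
        using j by blast
    qed
  qed
qed

end
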